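(* For all integers $m\ge2$ and $n\ge3$, the cylindrical grid graph $P_m\,\Box\,C_n$ is non-distance magic.
   Context: $P_m$ is the path on $m$ vertices, $C_n$ the cycle on $n$ vertices, and $\Box$ the Cartesian product of graphs. For a graph $G$ with $N(u)=\{v: uv\in E(G)\}$, a bijection $f:V(G)\to\{1,\dots,|V(G)|\}$ is a distance magic labeling if $\sum_{v\in N(u)}f(v)$ is the same for all $u\in V(G)$; $G$ is non-distance magic if it has no such labeling. *)

theory Defs
  imports Main "Graph_Theory.Pair_Digraph"
begin

text \<open>
  Graphs are finite simple undirected graphs, represented as in the library by the locale
  \<^locale>\<open>pair_graph\<close>: the arc set is a symmetric, irreflexive relation on the vertex set, so an
  edge \<open>uv\<close> appears as both arcs \<open>(u, v)\<close> and \<open>(v, u)\<close>.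
\<close>

definition path_graph :: "nat \<Rightarrow> nat pair_pre_digraph" where
  "path_graph m =
     \<lparr> pverts = {..<m},
       parcs = {(i, j). i < m \<and> j < m \<and> (j = Suc i \<or> i = Suc j)} \<rparr>"

text \<open>This is the cycle on \<open>n\<close> vertices for \<open>n \<ge> 3\<close> (for \<open>n = 1\<close> it has a loop).\<close>

definition cycle_graph :: "nat \<Rightarrow> nat pair_pre_digraph" where
  "cycle_graph n =
     \<lparr> pverts = {..<n},
       parcs = {(i, j). i < n \<and> j < n \<and> (j = Suc i mod n \<or> i = Suc j mod n)} \<rparr>"

definition cartesian_product ::
  "'a pair_pre_digraph \<Rightarrow> 'b pair_pre_digraph \<Rightarrow> ('a \<times> 'b) pair_pre_digraph" where
  "cartesian_product G H =
     \<lparr> pverts = pverts G \<times> pverts H,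
       parcs = {((u, x), (v, y)).
         (u = v \<and> u \<in> pverts G \<and> (x, y) \<in> parcs H) \<or>
         ((u, v) \<in> parcs G \<and> x = y \<and> x \<in> pverts H)} \<rparr>"

definition neighborhood :: "'a pair_pre_digraph \<Rightarrow> 'a \<Rightarrow> 'a set" where
  "neighborhood G u = {v. (u, v) \<in> parcs G}"

definition distance_magic_labeling :: "'a pair_pre_digraph \<Rightarrow> ('a \<Rightarrow> nat) \<Rightarrow> bool" where
  "distance_magic_labeling G f \<longleftrightarrow>
     bij_betw f (pverts G) {1..card (pverts G)} \<and>
     (\<exists>k. \<forall>u \<in> pverts G. (\<Sum>v \<in> neighborhood G u. f v) = k)"

definition non_distance_magic :: "'a pair_pre_digraph \<Rightarrow> bool" where
  "non_distance_magic G \<longleftrightarrow> \<not> (\<exists>f. distance_magic_labeling G f)"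

lemma pair_graphI:
  assumes "finite (pverts G)"
    and "\<And>u v. (u, v) \<in> parcs G \<Longrightarrow> u \<in> pverts G \<and> v \<in> pverts G"
    and "\<And>u v. (u, v) \<in> parcs G \<Longrightarrow> (v, u) \<in> parcs G"
    and "\<And>u. (u, u) \<notin> parcs G"
  shows "pair_graph G"
proof -
  have "finite (parcs G)"
    by (rule finite_subset[of _ "pverts G \<times> pverts G"]) (use assms(1,2) in auto)
  with assms show ?thesis
    by unfold_locales (auto simp: symmetric_def sym_def)
qed

lemma pair_graph_path_graph: "pair_graph (path_graph m)"
  by (rule pair_graphI) (auto simp: path_graph_def)

lemma pair_graph_cycle_graph:
  assumes "n \<ge> 3"
  shows "pair_graph (cycle_graph n)"
  using assms by (intro pair_graphI) (auto simp: cycle_graph_def mod_Suc split: if_splits)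

lemma pair_graph_cartesian_product:
  assumes "pair_graph G" "pair_graph H"
  shows "pair_graph (cartesian_product G H)"
proof -
  interpret G: pair_graph G by fact
  interpret H: pair_graph H by fact
  show ?thesis
  proof (rule pair_graphI)
    show "finite (pverts (cartesian_product G H))"
      using G.pair_finite_verts H.pair_finite_verts by (simp add: cartesian_product_def)
  next
    fix p q assume "(p, q) \<in> parcs (cartesian_product G H)"
    then show "p \<in> pverts (cartesian_product G H) \<and> q \<in> pverts (cartesian_product G H)"
      by (auto simp: cartesian_product_def dest: G.in_arcsD1 G.in_arcsD2 H.in_arcsD1 H.in_arcsD2)
  next
    fix p q assume "(p, q) \<in> parcs (cartesian_product G H)"
    then show "(q, p) \<in> parcs (cartesian_product G H)"
      using G.pair_sym_arcs H.pair_sym_arcs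
      by (auto simp: cartesian_product_def symmetric_def sym_def)
  next
    fix p show "(p, p) \<notin> parcs (cartesian_product G H)"
      by (auto simp: cartesian_product_def dest: G.pair_no_loops H.pair_no_loops)
  qed
qed

end

theory Submission
  imports Defs
begin

text \<open>
  Number the rows \<open>1, \<dots>, m\<close> and add zero rows \<open>0\<close> and \<open>m + 1\<close>, so that a labeling \<open>F\<close> with magic
  constant \<open>k\<close> satisfies the same four-term equation in every row. The diagonal sums
  \<open>G i j = F i j + F (i + 1) (j + 1)\<close> then satisfy \<open>G (i + 1) j + G i (j + 1) = k\<close>. If \<open>m\<close> is even,
  this transports \<open>G 0\<close> to \<open>G m\<close> and gives \<open>F m 0 = F 1 (m + 1)\<close>, against injectivity. If \<open>m\<close> is
  odd, the row totals \<open>R i\<close> satisfy \<open>R (2 t) = t R 2\<close>, so \<open>R (m + 1) = 0\<close> forces \<open>R 2 = 0\<close>,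
  against positivity.
\<close>

lemma four_term_first_last_row:
  fixes F :: "nat \<Rightarrow> nat \<Rightarrow> nat"
  assumes eq: "\<And>i j. i < m \<Longrightarrow>
      F i (j + 1) + F (i + 2) (j + 1) + F (i + 1) j + F (i + 1) (j + 2) = k"
    and bot: "\<And>j. F 0 j = 0" and top: "\<And>j. F (m + 1) j = 0"
    and "even m"
  shows "F m j = F 1 (j + m + 1)"
proof -
  define G where "G i j = F i j + F (i + 1) (j + 1)" for i j
  \<comment> \<open>The four neighbours of \<open>(i + 1, j + 1)\<close> split into two parallel
    diagonal pairs: upper with right, left with lower.\<close>
  have step: "G (i + 1) j + G i (j + 1) = k" if "i < m" for i j
    using eq[OF that, of j] by (simp add: G_def numeral_2_eq_2)
  have diag: "G (2 * t) j = G 0 (j + 2 * t)" if "2 * t \<le> m" for t j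
    using that
  proof (induction t arbitrary: j)
    case (Suc t)
    \<comment> \<open>Both sides complement \<open>G (2 * t + 1) (j + 1)\<close> to
      \<open>k\<close>.\<close>
    have "G (2 * Suc t) j = G (2 * t) (j + 2)"
      using step[of "2 * t + 1" j] step[of "2 * t" "j + 1"] Suc.prems by simp
    with Suc show ?case by simp
  qed simp
  from \<open>even m\<close> obtain t where "m = 2 * t" by (elim evenE)
  \<comment> \<open>The zero rows reduce each of \<open>G m j\<close> and \<open>G 0 (j + m)\<close>
    to a single entry.\<close>
  with diag[of t j] top[of "j + 1"] show ?thesis by (simp add: G_def bot)
qed

lemma sum_lessThan_shift_periodic:
  fixes g :: "nat \<Rightarrow> 'a::cancel_comm_monoid_add"
  assumes "g n = g 0"
  shows "(\<Sum>j<n. g (j + 1)) = (\<Sum>j<n. g j)"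
  using sum.lessThan_Suc_shift[of g n] sum.lessThan_Suc[of g n] assms
  by (simp add: add.commute)

text \<open>Summing over a full period removes the horizontal shifts and leaves a linear recurrence
  for the row totals.\<close>

lemma four_term_row_sum:
  fixes F :: "nat \<Rightarrow> nat \<Rightarrow> nat"
  assumes eq: "\<And>i j. i < m \<Longrightarrow>
      F i (j + 1) + F (i + 2) (j + 1) + F (i + 1) j + F (i + 1) (j + 2) = k"
    and bot: "\<And>j. F 0 j = 0" and top: "\<And>j. F (m + 1) j = 0"
    and periodic: "\<And>i j. F i (j + n) = F i j"
    and "odd m"
  shows "(\<Sum>j<n. F 2 j) = 0"
proof -
  define R where "R i = (\<Sum>j<n. F i j)" for i
  have shift: "(\<Sum>j<n. F i (j + 1)) = R i" "(\<Sum>j<n. F i (j + 2)) = R i" for i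
  proof -
    show 1: "(\<Sum>j<n. F i (j + 1)) = R i"
      unfolding R_def using periodic[of i 0] by (intro sum_lessThan_shift_periodic) simp
    show "(\<Sum>j<n. F i (j + 2)) = R i"
      using sum_lessThan_shift_periodic[of "\<lambda>j. F i (j + 1)" n] 1 periodic[of i 1]
      by (simp add: add.commute)
  qed
  have row: "R i + R (i + 2) + 2 * R (i + 1) = n * k" if "i < m" for i
  proof -
    have "n * k = (\<Sum>j<n. F i (j + 1) + F (i + 2) (j + 1) + F (i + 1) j + F (i + 1) (j + 2))"
      by (simp only: eq[OF that] sum_constant card_lessThan of_nat_id)
    also have "\<dots> = R i + R (i + 2) + R (i + 1) + R (i + 1)"
      by (simp only: sum.distrib shift R_def)
    finally show ?thesis by simp
  qed
  have R0: "R 0 = 0" by (simp add: R_def bot)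
  \<comment> \<open>Adding the recurrences at \<open>2 * t\<close> and \<open>2 * t + 2\<close> and
    subtracting twice the one at \<open>2 * t + 1\<close> shows that the even-indexed totals have
    second difference zero. The second conjunct states the constant increment without
    subtraction.\<close>
  have "R (2 * t) = t * R 2 \<and> R (2 * t + 2) = R (2 * t) + R 2" if "2 * t < m" for t
    using that
  proof (induction t)
    case 0
    then show ?case using R0 by (simp add: numeral_2_eq_2)
  next
    case (Suc t)
    from Suc.prems have "2 * t < m" "2 * t + 1 < m" by auto
    then show ?case
      using Suc.IH row[of "2 * t"] row[of "2 * t + 1"] row[OF Suc.prems]
      by (simp add: numeral_eq_Suc)
  qed
  moreover from \<open>odd m\<close> obtain t where "m = 2 * t + 1" by (elim oddE)
  moreover have "R (m + 1) = 0" by (simp add: R_def top[simplified])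
  ultimately have "R 2 = 0" by force
  then show ?thesis by (simp add: R_def)
qed

text \<open>Centring at column \<open>j + 1\<close> names the left neighbour \<open>j mod n\<close>
  without subtraction.\<close>

lemma neighborhood_cylinder:
  assumes "a < m" "n \<ge> 3"
  shows "neighborhood (cartesian_product (path_graph m) (cycle_graph n)) (a, (j + 1) mod n) =
    {(a, j mod n), (a, (j + 2) mod n)} \<union>
    (\<lambda>i. (i, (j + 1) mod n)) ` ({i. a = Suc i} \<union> {i. i = Suc a \<and> i < m})"
proof -
  have "(j + 1) mod n = Suc y mod n \<longleftrightarrow> y = j mod n" if "y < n" for y
  proof -
    have "(j + 1) mod n = Suc y mod n \<longleftrightarrow> j mod n = y mod n"
      by (auto simp: mod_Suc split: if_splits)
    with that show ?thesis by auto
  qed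
  moreover have "Suc ((j + 1) mod n) mod n = (j + 2) mod n"
    by (simp add: mod_Suc_eq)
  ultimately show ?thesis
    using assms
    by (auto simp: neighborhood_def cartesian_product_def path_graph_def cycle_graph_def)
qed

lemma sum_neighborhood_cylinder:
  fixes f :: "nat \<times> nat \<Rightarrow> nat"
  assumes "a < m" "n \<ge> 3"
  shows "(\<Sum>v \<in> neighborhood (cartesian_product (path_graph m) (cycle_graph n)) (a, (j + 1) mod n). f v) =
    (if a = 0 then 0 else f (a - 1, (j + 1) mod n)) +
    (if Suc a < m then f (Suc a, (j + 1) mod n) else 0) +
    f (a, j mod n) + f (a, (j + 2) mod n)"
proof -
  \<comment> \<open>On a cycle of length at least 3 the left and right neighbours differ, so both
    labels count.\<close>
  have ne: "j mod n \<noteq> (j + 2) mod n"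
    using \<open>n \<ge> 3\<close> by (auto simp: mod_Suc split: if_splits)
  have below: "{i. a = Suc i} = (if a = 0 then {} else {a - 1})" by auto
  have above: "{i. i = Suc a \<and> i < m} = (if Suc a < m then {Suc a} else {})" by auto
  show ?thesis
    unfolding neighborhood_cylinder[OF assms] below above using ne by auto
qed

theorem theorem3p7:
  fixes m n :: nat
  assumes "m \<ge> 2" and "n \<ge> 3"
  shows "non_distance_magic (cartesian_product (path_graph m) (cycle_graph n))"
  unfolding non_distance_magic_def
proof
  let ?P = "cartesian_product (path_graph m) (cycle_graph n)"
  assume "\<exists>f. distance_magic_labeling ?P f"
  then obtain f k where bij: "bij_betw f (pverts ?P) {1..card (pverts ?P)}"
    and magic: "\<And>u. u \<in> pverts ?P \<Longrightarrow> (\<Sum>v \<in> neighborhood ?P u. f v) = k"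
    unfolding distance_magic_labeling_def by blast
  have verts: "pverts ?P = {..<m} \<times> {..<n}"
    by (simp add: cartesian_product_def path_graph_def cycle_graph_def)
  \<comment> \<open>Rows are shifted by one to make room for row \<open>0\<close>; columns are
    unrolled periodically.\<close>
  define F where "F i j = (if i = 0 \<or> i > m then 0 else f (i - 1, j mod n))" for i j
  have eq: "F i (j + 1) + F (i + 2) (j + 1) + F (i + 1) j + F (i + 1) (j + 2) = k"
    if "i < m" for i j
    using magic[of "(i, (j + 1) mod n)"] sum_neighborhood_cylinder[OF that \<open>n \<ge> 3\<close>, of f j]
      that \<open>n \<ge> 3\<close> by (simp add: F_def verts)
  have bot: "F 0 j = 0" and top: "F (m + 1) j = 0" and periodic: "F i (j + n) = F i j" for i j
    by (simp_all add: F_def)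
  show False
  proof (cases "even m")
    case True
    have "F m 0 = F 1 (0 + m + 1)"
      by (rule four_term_first_last_row[OF eq bot top True])
    then have "f (m - 1, 0) = f (0, (m + 1) mod n)"
      using \<open>m \<ge> 2\<close> by (simp add: F_def)
    then have "(m - 1, 0) = (0, (m + 1) mod n)"
      using \<open>m \<ge> 2\<close> \<open>n \<ge> 3\<close> by (intro inj_onD[OF bij_betw_imp_inj_on[OF bij]]) (auto simp: verts)
    with \<open>m \<ge> 2\<close> show False by simp
  next
    case False
    have "(\<Sum>j<n. F 2 j) = 0"
      by (rule four_term_row_sum[OF eq bot top periodic False])
    \<comment> \<open>Row \<open>2\<close> of \<open>F\<close> is a genuine row because
      \<open>m\<close> \<ge> 2.\<close>
    then have "f (1, 0) = 0"
      using \<open>m \<ge> 2\<close> \<open>n \<ge> 3\<close> by (auto simp: F_def)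
    moreover have "f (1, 0) \<in> {1..card (pverts ?P)}"
      using \<open>m \<ge> 2\<close> \<open>n \<ge> 3\<close> by (intro bij_betw_apply[OF bij]) (auto simp: verts)
    ultimately show False by simp
  qed
qed

end
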